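(* For every $n\ge1$, let $\epsilon$ be a primitive $n$-th root of unity, let $\mathbf{M}_n=(\epsilon^{jk})_{1\le j,k\le n}$ (Schur's matrix) and $P_n=\mathrm{per}(\mathbf{M}_n)$. Then $|P_n|\le TS(n)\le S(n)$.
   Context: $\mathrm{per}(A)=\sum_{\sigma\in S_n}\prod_i a_{i,\sigma(i)}$. Board squares of the $n\times n$ board are $(i,j)$ (row $i$, column $j$). $S(n)$ is the number of placements of $n$ pieces (semi-queens) with no two sharing a row, a column, or a value of $j-i$. $TS(n)$ (toroidal semi-queens) is the number of placements of $n$ pieces with no two sharing a row, a column, or a value of $j-i \bmod n$ (equivalently, the number of transversals of the cyclic Latin square of order $n$). *)

theory Defs
  imports Complex_Main "HOL-Combinatorics.Permutations"
begin

text \<open>Rows and columns are numbered \<open>1, \<dots>, n\<close>; entries outside that range are ignored.\<close>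

definition per :: "nat \<Rightarrow> (nat \<Rightarrow> nat \<Rightarrow> 'a::comm_semiring_1) \<Rightarrow> 'a" where
  "per n A = (\<Sum>\<sigma> | \<sigma> permutes {1..n}. \<Prod>i\<in>{1..n}. A i (\<sigma> i))"

definition primitive_root_of_unity :: "nat \<Rightarrow> complex \<Rightarrow> bool" where
  "primitive_root_of_unity n \<epsilon> \<longleftrightarrow> 0 < n \<and> \<epsilon> ^ n = 1 \<and> (\<forall>k. 0 < k \<and> k < n \<longrightarrow> \<epsilon> ^ k \<noteq> 1)"

definition schur_matrix :: "complex \<Rightarrow> nat \<Rightarrow> nat \<Rightarrow> complex" where
  "schur_matrix \<epsilon> j k = \<epsilon> ^ (j * k)"

definition board :: "nat \<Rightarrow> (nat \<times> nat) set" where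
  "board n = {1..n} \<times> {1..n}"

text \<open>
  The pieces are indistinguishable, so a placement is the set of its occupied squares
  \<open>(row, column)\<close>. That no two pieces share a value of a function \<open>f\<close> of the square is
  injectivity of \<open>f\<close> on the placement. Differences are taken in \<open>int\<close> because subtraction on
  \<open>nat\<close> truncates.
\<close>

definition semi_queen_placements :: "nat \<Rightarrow> (nat \<times> nat) set set" where
  "semi_queen_placements n =
     {Q. Q \<subseteq> board n \<and> card Q = n \<and> inj_on fst Q \<and> inj_on snd Q \<and>
         inj_on (\<lambda>(i, j). int j - int i) Q}"

definition toroidal_semi_queen_placements :: "nat \<Rightarrow> (nat \<times> nat) set set" where
  "toroidal_semi_queen_placements n =
     {Q. Q \<subseteq> board n \<and> card Q = n \<and> inj_on fst Q \<and> inj_on snd Q \<and>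
         inj_on (\<lambda>(i, j). (int j - int i) mod int n) Q}"

definition S :: "nat \<Rightarrow> nat" where
  "S n = card (semi_queen_placements n)"

definition TS :: "nat \<Rightarrow> nat" where
  "TS n = card (toroidal_semi_queen_placements n)"

end

theory Submission
  imports Defs Jordan_Normal_Form.Determinant
begin

text \<open>
  The circulant determinant with entries \<open>x\<^sub>d\<close> on the diagonals \<open>j - i \<equiv> d (mod n)\<close> equals
  \<open>\<Prod>\<^sub>k \<Sum>\<^sub>d \<epsilon>\<^bsup>dk\<^esup> x\<^sub>d\<close>. The coefficient of \<open>x\<^sub>1 \<cdots> x\<^sub>n\<close> is the permanent of Schur's matrix on the
  product side, and on the determinant side a sum of signs over the placements of toroidal
  semi-queens. The coefficient is extracted by evaluating at the indicators of all subsets \<open>T\<close> of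
  \<open>{1..n}\<close> and summing with weights \<open>(-1)\<^bsup>n - |T|\<^esup>\<close>.
\<close>

section \<open>Coefficient extraction by inclusion-exclusion\<close>

lemma sum_Pow_superset_alternating:
  fixes B C :: "'b set"
  assumes "finite B"
  shows "(\<Sum>T\<in>Pow B. (- 1) ^ card (B - T) * of_bool (B \<inter> C \<subseteq> T)) = (of_bool (B \<subseteq> C) :: 'a::comm_ring_1)"
proof -
  have prod_of_bool: "(\<Prod>b\<in>A. of_bool (P b)) = (of_bool (\<forall>b\<in>A. P b) :: 'a)" if "finite A"
    for A :: "'b set" and P
    using that by induction auto
  have "(of_bool (B \<subseteq> C) :: 'a) = (\<Prod>b\<in>B. of_bool (b \<in> C))"
    using assms by (auto simp: prod_of_bool)
  also have "\<dots> = (\<Prod>b\<in>B. 1 + (- 1) * of_bool (b \<notin> C))"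
    by (intro prod.cong) auto
  \<comment> \<open>Expand the product: \<open>T\<close> collects the factors that contribute their
    summand 1, and \<open>B - T\<close> those that contribute the negative indicator.\<close>
  also have "\<dots> = (\<Sum>T\<in>Pow B. (- 1) ^ card (B - T) * of_bool (\<forall>b\<in>B - T. b \<notin> C))"
    unfolding prod_add[OF assms]
    by (intro sum.cong refl)
       (simp only: prod.distrib prod.neutral_const prod_constant mult_1_left prod_of_bool finite_Diff assms)
  also have "\<dots> = (\<Sum>T\<in>Pow B. (- 1) ^ card (B - T) * of_bool (B \<inter> C \<subseteq> T))"
    by (intro sum.cong refl arg_cong2[of _ _ _ _ "(*)"] arg_cong[of _ _ of_bool]) auto
  finally show ?thesis by simp
qed

text \<open>The product of indicators tests whether the whole image of \<open>f\<close> lies in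
  \<open>T\<close>, so the previous sieve applies to that image. When \<open>A\<close> and
  \<open>B\<close> have equally many elements, the surjections that survive are exactly the
  bijections, as for the coefficient of a squarefree monomial.\<close>

lemma alternating_sum_indicator_prod:
  fixes f :: "'i \<Rightarrow> 'b"
  assumes "finite A" "finite B" "f ` A \<subseteq> B"
  shows "(\<Sum>T\<in>Pow B. (- 1) ^ card (B - T) * (\<Prod>i\<in>A. of_bool (f i \<in> T))) =
    (of_bool (f ` A = B) :: 'a::comm_ring_1)"
proof -
  have "(\<Prod>i\<in>A. of_bool (f i \<in> T)) = (of_bool (B \<inter> f ` A \<subseteq> T) :: 'a)" for T
    using assms(1,3) by (induction) auto
  moreover have "f ` A = B \<longleftrightarrow> B \<subseteq> f ` A"
    using assms(3) by auto
  ultimately show ?thesis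
    using sum_Pow_superset_alternating[OF assms(2), of "f ` A"] by simp
qed

text \<open>Ryser's formula. The product of row sums expands over all maps from rows to columns, and
  the alternating sum over \<open>T\<close> keeps the permutations.\<close>

lemma per_alternating_sum:
  fixes A :: "nat \<Rightarrow> nat \<Rightarrow> 'a::comm_ring_1"
  shows "per n A = (\<Sum>T\<in>Pow {1..n}. (- 1) ^ card ({1..n} - T) *
    (\<Prod>k\<in>{1..n}. \<Sum>d\<in>{1..n}. A k d * of_bool (d \<in> T)))"
proof -
  let ?N = "{1..n}"
  let ?w = "\<lambda>T. (- 1) ^ card (?N - T) :: 'a"
  let ?E = "?N \<rightarrow>\<^sub>E ?N"
  have "(\<Sum>T\<in>Pow ?N. ?w T * (\<Prod>k\<in>?N. \<Sum>d\<in>?N. A k d * of_bool (d \<in> T)))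
      = (\<Sum>T\<in>Pow ?N. \<Sum>g\<in>?E. ?w T * ((\<Prod>k\<in>?N. A k (g k)) * (\<Prod>k\<in>?N. of_bool (g k \<in> T))))"
    by (simp only: prod_sum_PiE finite_atLeastAtMost sum_distrib_left prod.distrib)
  also have "\<dots> = (\<Sum>g\<in>?E. (\<Prod>k\<in>?N. A k (g k)) * (\<Sum>T\<in>Pow ?N. ?w T * (\<Prod>k\<in>?N. of_bool (g k \<in> T))))"
    by (subst sum.swap) (simp add: sum_distrib_left mult_ac)
  also have "\<dots> = (\<Sum>g\<in>?E. (\<Prod>k\<in>?N. A k (g k)) * of_bool (g ` ?N = ?N))"
    by (intro sum.cong refl arg_cong2[of _ _ _ _ "(*)"] alternating_sum_indicator_prod) auto
  also have "\<dots> = (\<Sum>g\<in>{g\<in>?E. g ` ?N = ?N}. \<Prod>k\<in>?N. A k (g k))"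
    by (intro sum.mono_neutral_cong_right) (auto intro: finite_PiE)
  also have "\<dots> = per n A"
    unfolding per_def
  \<comment> \<open>Outside \<open>?N\<close>, members of \<open>?E\<close> are
    \<open>undefined\<close> whereas permutations are the identity; the two witnesses exchange these
    default values.\<close>
  proof (rule sum.reindex_bij_witness[where i = "\<lambda>p. restrict p ?N" and j = "\<lambda>g. restrict_id g ?N"])
    fix g assume g: "g \<in> {g\<in>?E. g ` ?N = ?N}"
    then have "bij_betw g ?N ?N"
      by (auto simp: bij_betw_def intro: eq_card_imp_inj_on)
    then show "restrict_id g ?N \<in> {p. p permutes ?N}"
      by (auto intro: permutes_restrict_id)
    show "restrict (restrict_id g ?N) ?N = g"
      using g by (auto simp: fun_eq_iff PiE_def extensional_def)
    show "(\<Prod>i\<in>?N. A i (restrict_id g ?N i)) = (\<Prod>i\<in>?N. A i (g i))"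
      by (intro prod.cong) auto
  next
    fix p assume "p \<in> {p. p permutes ?N}"
    then have p: "p permutes ?N" by simp
    show "restrict_id (restrict p ?N) ?N = p"
      using permutes_not_in[OF p] by (auto simp: fun_eq_iff restrict_id_def)
    show "restrict p ?N \<in> {g\<in>?E. g ` ?N = ?N}"
      using permutes_image[OF p] permutes_in_image[OF p] by auto
  qed
  finally show ?thesis by simp
qed

section \<open>Roots of unity and cyclic differences\<close>

lemma primitive_root_power_eq_1_dvd:
  assumes "primitive_root_of_unity n \<epsilon>" "\<epsilon> ^ m = 1"
  shows "n dvd m"
proof (rule ccontr)
  assume "\<not> n dvd m"
  then have "0 < m mod n"
    by (simp add: dvd_eq_mod_eq_0)
  moreover have "m mod n < n"
    using assms(1) by (simp add: primitive_root_of_unity_def)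
  moreover have "\<epsilon> ^ (m mod n) = 1"
  proof -
    have "\<epsilon> ^ m = (\<epsilon> ^ n) ^ (m div n) * \<epsilon> ^ (m mod n)"
      by (simp flip: power_mult power_add)
    then show ?thesis
      using assms by (simp add: primitive_root_of_unity_def)
  qed
  ultimately show False
    using assms(1) by (simp add: primitive_root_of_unity_def)
qed

text \<open>The representative in \<open>{1..n}\<close> of \<open>j - i\<close> modulo \<open>n\<close>, for \<open>i, j < n\<close>.\<close>

definition cyclic_diff :: "nat \<Rightarrow> nat \<Rightarrow> nat \<Rightarrow> nat" where
  "cyclic_diff n i j = (if i < j then j - i else n + j - i)"

lemma cyclic_diff_range: "i < n \<Longrightarrow> j < n \<Longrightarrow> cyclic_diff n i j \<in> {1..n}"
  by (auto simp: cyclic_diff_def)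

lemma bij_betw_cyclic_diff:
  assumes "i < n"
  shows "bij_betw (cyclic_diff n i) {0..<n} {1..n}"
proof -
  have inj: "inj_on (cyclic_diff n i) {0..<n}"
    using assms by (auto simp: inj_on_def cyclic_diff_def split: if_splits)
  moreover have "cyclic_diff n i ` {0..<n} \<subseteq> {1..n}"
    using assms by (auto simp: cyclic_diff_def)
  ultimately have "cyclic_diff n i ` {0..<n} = {1..n}"
    by (intro card_subset_eq) (auto simp: card_image)
  with inj show ?thesis by (simp add: bij_betw_def)
qed

lemma int_cyclic_diff_mod:
  assumes "i < n"
  shows "(int j - int i) mod int n = int (cyclic_diff n i j) mod int n"
proof (cases "i < j")
  case True
  then show ?thesis by (simp add: cyclic_diff_def of_nat_diff)
next
  case False
  then have "int (cyclic_diff n i j) = (int j - int i) + int n"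
    using assms by (simp add: cyclic_diff_def of_nat_diff)
  then show ?thesis by simp
qed

lemma power_add_cyclic_diff:
  fixes z :: "'a::monoid_mult"
  assumes "z ^ n = 1" "i < n"
  shows "z ^ (i + cyclic_diff n i j) = z ^ j"
proof (cases "i < j")
  case False
  then have "i + cyclic_diff n i j = n + j"
    using assms by (simp add: cyclic_diff_def)
  then show ?thesis using assms by (simp add: power_add)
qed (simp add: cyclic_diff_def)

section \<open>The circulant determinant\<close>

lemma det_diagonal:
  fixes d :: "nat \<Rightarrow> 'a::comm_ring_1"
  shows "det (mat n n (\<lambda>(i, j). if i = j then d i else 0)) = (\<Prod>k = 0..<n. d k)"
proof -
  let ?D = "mat n n (\<lambda>(i, j). if i = j then d i else 0)"
  have "det ?D = prod_list (diag_mat ?D)"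
    by (rule det_upper_triangular[of _ n]) auto
  then show ?thesis by (simp add: prod_list_diag_prod)
qed

lemma det_fourier_nonzero:
  assumes "primitive_root_of_unity n \<epsilon>"
  shows "det (mat n n (\<lambda>(i, k). \<epsilon> ^ (i * Suc k))) \<noteq> 0"
proof
  let ?F = "mat n n (\<lambda>(i, k). \<epsilon> ^ (i * Suc k))"
  \<comment> \<open>The exponent \<open>n - j\<close> stands for \<open>-j\<close>, so
    \<open>?G\<close> is the conjugate transpose of the Fourier matrix \<open>?F\<close>. Their
    product is \<open>n\<close> times the identity, since off the diagonal the geometric sums
    vanish.\<close>
  let ?G = "mat n n (\<lambda>(k, j). \<epsilon> ^ ((n - j) * Suc k))"
  have n: "0 < n" "\<epsilon> ^ n = 1"
    using assms by (auto simp: primitive_root_of_unity_def)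
  have "?F * ?G = mat n n (\<lambda>(i, j). if i = j then of_nat n else 0)"
  proof (rule eq_matI)
    fix i j assume "i < dim_row (mat n n (\<lambda>(i, j). if i = j then of_nat n else (0::complex)))"
      and "j < dim_col (mat n n (\<lambda>(i, j). if i = j then of_nat n else (0::complex)))"
    then have ij: "i < n" "j < n" by auto
    define \<omega> where "\<omega> = \<epsilon> ^ (i + (n - j))"
    have "(?F * ?G) $$ (i, j) = (\<Sum>k = 0..<n. \<epsilon> ^ (i * Suc k) * \<epsilon> ^ ((n - j) * Suc k))"
      using ij by (simp add: scalar_prod_def)
    also have "\<dots> = (\<Sum>k = 0..<n. \<omega> ^ Suc k)"
      by (simp only: \<omega>_def power_mult[symmetric] power_add[symmetric] distrib_right)
    also have "\<dots> = \<omega> * (\<Sum>k<n. \<omega> ^ k)"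
      by (simp add: sum_distrib_left atLeast0LessThan)
    also have "\<dots> = (if i = j then of_nat n else 0)"
    proof (cases "i = j")
      case True
      then have "\<omega> = 1" using ij n by (simp add: \<omega>_def)
      then show ?thesis using True by simp
    next
      case False
      \<comment> \<open>Between 0 and \<open>2 * n\<close> exclusively, the only multiple of
        \<open>n\<close> is \<open>n\<close> itself, which would force \<open>i = j\<close>.
        Primitivity then gives \<open>\<omega> \<noteq> 1\<close>.\<close>
      have "\<not> n dvd i + (n - j)"
      proof
        assume "n dvd i + (n - j)"
        then obtain q where q: "i + (n - j) = n * q" by blast
        moreover have "0 < i + (n - j)" "i + (n - j) < n * 2" "i + (n - j) \<noteq> n"
          using ij False by auto
        ultimately have "0 < q" "q < 2" "q \<noteq> 1"
          by (auto intro: gr0I)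
        then show False by simp
      qed
      then have "\<omega> \<noteq> 1"
        using primitive_root_power_eq_1_dvd[OF assms] by (auto simp: \<omega>_def)
      moreover have "\<omega> ^ n = (\<epsilon> ^ n) ^ (i + (n - j))"
        by (simp add: \<omega>_def mult.commute flip: power_mult)
      ultimately show ?thesis
        using False n by (simp add: geometric_sum)
    qed
    finally show "(?F * ?G) $$ (i, j) = mat n n (\<lambda>(i, j). if i = j then of_nat n else 0) $$ (i, j)"
      using ij by simp
  qed auto
  moreover have "det (?F * ?G) = det ?F * det ?G"
    by (rule det_mult[of _ n]) auto
  ultimately have "det ?F * det ?G = of_nat n ^ n"
    by (simp add: det_diagonal)
  moreover assume "det ?F = 0"
  ultimately show False using n by simp
qed

text \<open>The columns of the Fourier matrix are eigenvectors of every circulant, and the factors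
  on the right are the eigenvalues. Hence \<open>?C * ?F = ?F * ?D\<close>, and the nonzero
  \<open>det ?F\<close> cancels. The shift \<open>Suc k\<close> reconciles matrix indices from 0
  with the numbering of Schur's matrix from 1.\<close>

lemma det_circulant:
  fixes x :: "nat \<Rightarrow> complex"
  assumes "primitive_root_of_unity n \<epsilon>"
  shows "det (mat n n (\<lambda>(i, j). x (cyclic_diff n i j))) =
    (\<Prod>k\<in>{1..n}. \<Sum>d\<in>{1..n}. \<epsilon> ^ (k * d) * x d)"
proof -
  let ?C = "mat n n (\<lambda>(i, j). x (cyclic_diff n i j))"
  let ?F = "mat n n (\<lambda>(i, k). \<epsilon> ^ (i * Suc k))"
  let ?l = "\<lambda>k. \<Sum>d\<in>{1..n}. \<epsilon> ^ (k * d) * x d"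
  let ?D = "mat n n (\<lambda>(i, j). if i = j then ?l (Suc i) else 0)"
  have n: "\<epsilon> ^ n = 1"
    using assms by (auto simp: primitive_root_of_unity_def)
  have "?C * ?F = ?F * ?D"
  proof (rule eq_matI)
    fix i k assume "i < dim_row (?F * ?D)" "k < dim_col (?F * ?D)"
    then have ik: "i < n" "k < n" by auto
    \<comment> \<open>Since \<open>j\<close> is congruent to \<open>i + cyclic_diff n i j\<close>
      modulo \<open>n\<close>, the eigenvector entry in row \<open>i\<close> splits off, and what
      remains depends on \<open>j\<close> only through the diagonal.\<close>
    have pow: "\<epsilon> ^ (j * Suc k) = \<epsilon> ^ (i * Suc k) * \<epsilon> ^ (Suc k * cyclic_diff n i j)" for j
    proof -
      have "\<epsilon> ^ (j * Suc k) = (\<epsilon> ^ (i + cyclic_diff n i j)) ^ Suc k"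
        using power_add_cyclic_diff[OF n ik(1)] by (simp only: power_mult)
      also have "\<dots> = \<epsilon> ^ (i * Suc k + Suc k * cyclic_diff n i j)"
        by (simp only: power_mult[symmetric] distrib_left mult.commute[of _ "Suc k"])
      finally show ?thesis by (simp only: power_add)
    qed
    have "(?C * ?F) $$ (i, k) = (\<Sum>j = 0..<n. x (cyclic_diff n i j) * \<epsilon> ^ (j * Suc k))"
      using ik by (simp add: scalar_prod_def)
    also have "\<dots> = \<epsilon> ^ (i * Suc k) *
        (\<Sum>j = 0..<n. \<epsilon> ^ (Suc k * cyclic_diff n i j) * x (cyclic_diff n i j))"
      unfolding sum_distrib_left by (intro sum.cong refl, subst pow) (simp only: mult_ac)
    also have "\<dots> = \<epsilon> ^ (i * Suc k) * ?l (Suc k)"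
      using sum.reindex_bij_betw[OF bij_betw_cyclic_diff[OF ik(1)], of "\<lambda>d. \<epsilon> ^ (Suc k * d) * x d"]
      by simp
    also have "\<dots> = (\<Sum>j = 0..<n. if j = k then \<epsilon> ^ (i * Suc j) * ?l (Suc j) else 0)"
      using ik by simp
    also have "\<dots> = (?F * ?D) $$ (i, k)"
      using ik by (simp add: scalar_prod_def if_distrib cong: if_cong)
    finally show "(?C * ?F) $$ (i, k) = (?F * ?D) $$ (i, k)" .
  qed auto
  moreover have "det (?C * ?F) = det ?C * det ?F" "det (?F * ?D) = det ?F * det ?D"
    by (rule det_mult[of _ n]; simp)+
  ultimately have "det ?C = det ?D"
    using det_fourier_nonzero[OF assms] by simp
  also have "\<dots> = (\<Prod>k = 0..<n. ?l (Suc k))"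
    by (rule det_diagonal)
  also have "\<dots> = (\<Prod>k\<in>{1..n}. ?l k)"
    by (simp only: One_nat_def prod.atLeast1_atMost_eq atLeast0LessThan)
  finally show ?thesis .
qed

section \<open>Schur's permanent as a signed count\<close>

definition cyclic_transversals :: "nat \<Rightarrow> (nat \<Rightarrow> nat) set" where
  "cyclic_transversals n =
    {p. p permutes {0..<n} \<and> (\<lambda>i. cyclic_diff n i (p i)) ` {0..<n} = {1..n}}"

text \<open>In Ryser's formula each product of row sums is a circulant determinant whose entries are
  indicators of \<open>T\<close>. After the Leibniz expansion the sieve keeps the permutations that
  meet every diagonal, which is why \<open>cyclic_transversals\<close> is phrased by
  surjectivity.\<close>

lemma per_schur_matrix_eq_signed_transversals:
  assumes "primitive_root_of_unity n \<epsilon>"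
  shows "per n (schur_matrix \<epsilon>) = (\<Sum>p\<in>cyclic_transversals n. signof p)"
proof -
  let ?N = "{1..n}"
  let ?P = "{p. p permutes {0..<n}}"
  let ?w = "\<lambda>T. (- 1) ^ card (?N - T) :: complex"
  have fin: "finite ?P" by (intro finite_permutations) simp
  have "per n (schur_matrix \<epsilon>) =
      (\<Sum>T\<in>Pow ?N. ?w T * det (mat n n (\<lambda>(i, j). of_bool (cyclic_diff n i j \<in> T))))"
    unfolding per_alternating_sum schur_matrix_def
    by (simp only: det_circulant[OF assms, of "\<lambda>d. of_bool (d \<in> _)"])
  also have "\<dots> = (\<Sum>T\<in>Pow ?N. \<Sum>p\<in>?P. ?w T *
      (signof p * (\<Prod>i = 0..<n. of_bool (cyclic_diff n i (p i) \<in> T))))"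
    unfolding det_def'[OF mat_carrier] sum_distrib_left
  proof (intro sum.cong refl arg_cong2[of _ _ _ _ "(*)"] prod.cong)
    fix T p i assume "p \<in> ?P" "i \<in> {0..<n}"
    then show "mat n n (\<lambda>(i, j). of_bool (cyclic_diff n i j \<in> T)) $$ (i, p i) =
        of_bool (cyclic_diff n i (p i) \<in> T)"
      using permutes_in_image[of p "{0..<n}" i] by simp
  qed
  also have "\<dots> = (\<Sum>p\<in>?P. signof p *
      (\<Sum>T\<in>Pow ?N. ?w T * (\<Prod>i = 0..<n. of_bool (cyclic_diff n i (p i) \<in> T))))"
    by (subst sum.swap) (simp add: sum_distrib_left mult_ac)
  also have "\<dots> = (\<Sum>p\<in>?P. signof p * of_bool ((\<lambda>i. cyclic_diff n i (p i)) ` {0..<n} = ?N))"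
  proof (intro sum.cong refl arg_cong2[of _ _ _ _ "(*)"] alternating_sum_indicator_prod)
    fix p assume "p \<in> ?P"
    then have "p i < n" if "i < n" for i
      using that permutes_in_image[of p "{0..<n}" i] by simp
    then show "(\<lambda>i. cyclic_diff n i (p i)) ` {0..<n} \<subseteq> ?N"
      using cyclic_diff_range by fastforce
  qed auto
  also have "\<dots> = (\<Sum>p\<in>cyclic_transversals n. signof p)"
    unfolding cyclic_transversals_def
    by (intro sum.mono_neutral_cong_right fin) auto
  finally show ?thesis .
qed

section \<open>Comparison with the numbers of placements\<close>

lemma finite_semi_queen_placements: "finite (semi_queen_placements n)"
  by (rule finite_subset[of _ "Pow (board n)"]) (auto simp: semi_queen_placements_def board_def)

text \<open>Equal differences are also equal modulo \<open>n\<close>, so the toroidal condition is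
  the stronger one.\<close>

lemma toroidal_subset_semi_queen_placements:
  "toroidal_semi_queen_placements n \<subseteq> semi_queen_placements n"
  unfolding toroidal_semi_queen_placements_def semi_queen_placements_def
  by (fastforce simp: inj_on_def split_beta)

text \<open>A permutation is sent to its graph, with both coordinates shifted from
  \<open>{0..<n}\<close> to \<open>{1..n}\<close>; the shift leaves differences unchanged.\<close>

lemma card_cyclic_transversals_le_TS: "card (cyclic_transversals n) \<le> TS n"
  unfolding TS_def
proof (rule card_inj_on_le[where f = "\<lambda>p. (\<lambda>i. (Suc i, Suc (p i))) ` {0..<n}"])
  let ?Q = "\<lambda>p::nat \<Rightarrow> nat. (\<lambda>i. (Suc i, Suc (p i))) ` {0..<n}"
  show "finite (toroidal_semi_queen_placements n)"
    by (rule finite_subset[OF toroidal_subset_semi_queen_placements finite_semi_queen_placements])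
  show "inj_on ?Q (cyclic_transversals n)"
  proof (rule inj_onI)
    fix p q assume pq: "p \<in> cyclic_transversals n" "q \<in> cyclic_transversals n" "?Q p = ?Q q"
    have "p i = q i" if "i < n" for i
    proof -
      have "(Suc i, Suc (p i)) \<in> ?Q q"
        using that pq(3) by (metis (no_types, lifting) atLeastLessThan_iff imageI zero_le)
      then show ?thesis by auto
    qed
    moreover have "p i = q i" if "\<not> i < n" for i
    proof -
      have "p permutes {0..<n}" "q permutes {0..<n}"
        using pq by (auto simp: cyclic_transversals_def)
      then show ?thesis
        using that permutes_not_in[of p _ i] permutes_not_in[of q _ i] by simp
    qed
    ultimately show "p = q" by blast
  qed
  show "?Q ` cyclic_transversals n \<subseteq> toroidal_semi_queen_placements n"
  proof (clarify)
    fix p assume "p \<in> cyclic_transversals n"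
    then have p: "p permutes {0..<n}" and surj: "(\<lambda>i. cyclic_diff n i (p i)) ` {0..<n} = {1..n}"
      by (auto simp: cyclic_transversals_def)
    have p_less: "p i < n" if "i < n" for i
      using that permutes_in_image[OF p, of i] by simp
    have inj: "inj_on (\<lambda>i. cyclic_diff n i (p i)) {0..<n}"
      by (rule eq_card_imp_inj_on) (simp_all add: surj)
    have inj_mod: "i = j" if "i < n" "j < n"
      "(int (p i) - int i) mod int n = (int (p j) - int j) mod int n" for i j
    proof -
      let ?a = "cyclic_diff n i (p i)" and ?b = "cyclic_diff n j (p j)"
      have range: "?a \<in> {1..n}" "?b \<in> {1..n}"
        using that p_less cyclic_diff_range by blast+
      have "int ?a mod int n = int ?b mod int n"
        using that by (simp add: int_cyclic_diff_mod)
      then have "?a mod n = ?b mod n"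
        by (metis of_nat_eq_iff zmod_int)
      \<comment> \<open>The representative \<open>n\<close> has residue 0 and all others are their
        own residues, hence the case split.\<close>
      then have "?a = ?b"
        using range by (cases "?a = n"; cases "?b = n") auto
      then show ?thesis using inj that by (auto dest: inj_onD)
    qed
    have "?Q p \<subseteq> board n"
      using p_less by (auto simp: board_def Suc_le_eq)
    moreover have "card (?Q p) = n"
      by (subst card_image) (auto simp: inj_on_def)
    moreover have "inj_on fst (?Q p)"
      by (auto simp: inj_on_def)
    moreover have "inj_on snd (?Q p)"
      using permutes_inj[OF p] by (auto simp: inj_on_def)
    moreover have "inj_on (\<lambda>(i, j). (int j - int i) mod int n) (?Q p)"
    proof (rule inj_onI, clarify)
      fix i j assume "i \<in> {0..<n}" "j \<in> {0..<n}"
        and "(int (Suc (p i)) - int (Suc i)) mod int n = (int (Suc (p j)) - int (Suc j)) mod int n"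
      then have "i = j" by (intro inj_mod) simp_all
      then show "Suc i = Suc j \<and> Suc (p i) = Suc (p j)" by simp
    qed
    ultimately show "?Q p \<in> toroidal_semi_queen_placements n"
      unfolding toroidal_semi_queen_placements_def by blast
  qed
qed

theorem theorem4p2:
  fixes n :: nat and \<epsilon> :: complex
  assumes "1 \<le> n"
    and "primitive_root_of_unity n \<epsilon>"
  shows "cmod (per n (schur_matrix \<epsilon>)) \<le> real (TS n) \<and> TS n \<le> S n"
proof
  \<comment> \<open>The triangle inequality discards the cancellation between even and odd
    transversals.\<close>
  have "cmod (per n (schur_matrix \<epsilon>)) \<le> (\<Sum>p\<in>cyclic_transversals n. cmod (signof p))"
    unfolding per_schur_matrix_eq_signed_transversals[OF assms(2)] by (rule norm_sum)
  also have "\<dots> = real (card (cyclic_transversals n))"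
  proof -
    have "cmod (signof p) = 1" for p :: "nat \<Rightarrow> nat"
      by (simp add: sign_def)
    then show ?thesis by simp
  qed
  also have "\<dots> \<le> real (TS n)"
    using card_cyclic_transversals_le_TS by simp
  finally show "cmod (per n (schur_matrix \<epsilon>)) \<le> real (TS n)" .
  show "TS n \<le> S n"
    unfolding TS_def S_def
    by (rule card_mono[OF finite_semi_queen_placements toroidal_subset_semi_queen_placements])
qed

end
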